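(* For every integer $n\geq 3$, \begin{align*} CP_{(4,0)}(n)=&\frac{1+q^{2n-4}+q^{2n-3}+q^{2n-2}}{(1-q^{2n-1})(1-q^{2n})}CP_{(4,0)}(n-1) -\frac{q^{4n-7}+q^{4n-8}+q^{4n-9}}{(1-q^{2n-3})(1-q^{2n-2})(1-q^{2n-1})(1-q^{2n})}CP_{(4,0)}(n-2)\\ &-\frac{q^{4n-10}}{(1-q^{2n-4})(1-q^{2n-3})(1-q^{2n-2})(1-q^{2n-1})(1-q^{2n})}CP_{(4,0)}(n-3). \end{align*}
   Context: A cylindric partition with profile $(c_1,c_2)$ is a pair of partitions $(\lambda^{(1)},\lambda^{(2)})$ (parts in weakly decreasing order, $\lambda^{(i)}_j=0$ beyond the number of parts) with $\lambda^{(1)}_j\ge\lambda^{(2)}_{j+c_2}$ and $\lambda^{(2)}_j\ge\lambda^{(1)}_{j+c_1}$ for all $j\ge1$; its size is $|\lambda^{(1)}|+|\lambda^{(2)}|$. $CP_{(4,0)}(n)$ is the generating function $\sum q^{\text{size}}$ over cylindric partitions of profile $(4,0)$ in which each partition has at most $n$ parts, with $CP_{(4,0)}(0)=1$. *)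

theory Defs
  imports "HOL-Computational_Algebra.Formal_Power_Series"
begin

text \<open>A partition is the list of its (positive) parts in weakly decreasing order.\<close>

definition partition :: "nat list \<Rightarrow> bool" where
  "partition l \<longleftrightarrow> sorted_wrt (\<ge>) l \<and> (\<forall>x\<in>set l. x > 0)"

text \<open>Parts are indexed from 1, and are 0 beyond the number of parts.\<close>

definition part :: "nat list \<Rightarrow> nat \<Rightarrow> nat" where
  "part l j = (if 1 \<le> j \<and> j \<le> length l then l ! (j - 1) else 0)"

definition cylindric_partition :: "nat \<times> nat \<Rightarrow> nat list \<times> nat list \<Rightarrow> bool" where
  "cylindric_partition = (\<lambda>(c1, c2) (l1, l2).
     partition l1 \<and> partition l2 \<and>
     (\<forall>j\<ge>1. part l1 j \<ge> part l2 (j + c2)) \<and>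
     (\<forall>j\<ge>1. part l2 j \<ge> part l1 (j + c1)))"

definition cyl_size :: "nat list \<times> nat list \<Rightarrow> nat" where
  "cyl_size = (\<lambda>(l1, l2). sum_list l1 + sum_list l2)"

definition cyl_set :: "nat \<times> nat \<Rightarrow> nat \<Rightarrow> nat \<Rightarrow> (nat list \<times> nat list) set" where
  "cyl_set c n m = {(l1, l2). cylindric_partition c (l1, l2) \<and>
     length l1 \<le> n \<and> length l2 \<le> n \<and> cyl_size (l1, l2) = m}"

definition CP :: "nat \<times> nat \<Rightarrow> nat \<Rightarrow> rat fps" where
  "CP c n = Abs_fps (\<lambda>m. of_nat (card (cyl_set c n m)))"

text \<open>Finiteness ensures that \<^const>\<open>card\<close> really counts the elements of \<^const>\<open>cyl_set\<close>.\<close>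

lemma finite_cyl_set: "finite (cyl_set c n m)"
proof -
  let ?L = "{l. set l \<subseteq> {..m} \<and> length l \<le> n}"
  have "cyl_set c n m \<subseteq> ?L \<times> ?L"
  proof
    fix p assume "p \<in> cyl_set c n m"
    then obtain l1 l2 where "p = (l1, l2)" "length l1 \<le> n" "length l2 \<le> n"
      "sum_list l1 + sum_list l2 = m"
      by (auto simp: cyl_set_def cyl_size_def)
    then show "p \<in> ?L \<times> ?L"
      using member_le_sum_list[of _ l1] member_le_sum_list[of _ l2] by fastforce
  qed
  moreover have "finite ?L" by (intro finite_lists_length_le) simp
  ultimately show ?thesis by (meson finite_SigmaI finite_subset)
qed

lemma CP_0: "CP c 0 = 1"
proof -
  have "cyl_set c 0 m = (if m = 0 then {([], [])} else {})" for m
    by (cases c) (auto simp: cyl_set_def cylindric_partition_def partition_def part_def cyl_size_def)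
  then show ?thesis by (auto simp: CP_def fps_eq_iff)
qed

end

theory Submission
  imports Defs
begin

unbundle fps_syntax

text \<open>
  Count the cylindric partitions of profile \<open>(4, 0)\<close> with separate bounds \<open>a\<close> and \<open>b\<close> on the
  numbers of parts of the two partitions, where \<open>b \<le> a \<le> b + 4\<close>. If both bounds are attained,
  then subtracting 1 from every part is a bijection; otherwise one of the bounds can be lowered.
  Inclusion-exclusion gives a recurrence in \<open>(a, b)\<close>, whose boundary cases are \<open>a = b\<close> and
  \<open>a = b + 4\<close>. Eliminating the series with \<open>a - b \<noteq> 0\<close> leaves a recurrence of order three for
  the diagonal.
\<close>

section \<open>Subtracting 1 from every part, and the inverse operation\<close>

text \<open>In Young diagram terms the first column is removed. Parts equal to 1 become 0 and are
  filtered out, since a \<open>partition\<close> lists positive parts only.\<close>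

definition dec_parts :: "nat list \<Rightarrow> nat list" where
  "dec_parts l = filter (\<lambda>x. x > 0) (map (\<lambda>x. x - 1) l)"

text \<open>Prepends a column of height \<open>a\<close>, provided that
  \<open>length l \<le> a\<close>: the implicit zero parts up to index \<open>a\<close> become
  ones.\<close>

definition inc_parts :: "nat \<Rightarrow> nat list \<Rightarrow> nat list" where
  "inc_parts a l = map Suc l @ replicate (a - length l) 1"

lemma partition_Nil [simp]: "partition []"
  by (simp add: partition_def)

lemma partition_Cons:
  "partition (x # l) \<longleftrightarrow> x > 0 \<and> (\<forall>y\<in>set l. y \<le> x) \<and> partition l"
  by (auto simp: partition_def)

lemma part_Nil [simp]: "part [] j = 0"
  by (simp add: part_def)

lemma part_Cons: "part (x # l) j = (if j = 0 then 0 else if j = 1 then x else part l (j - 1))"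
proof (cases j)
  case (Suc i)
  then show ?thesis by (cases i) (auto simp: part_def)
qed (simp add: part_def)

lemma part_pos_iff: "partition l \<Longrightarrow> part l j > 0 \<longleftrightarrow> 1 \<le> j \<and> j \<le> length l"
  by (auto simp: part_def partition_def)

lemma dec_parts_all_one: "\<forall>y\<in>set l. y \<le> 1 \<Longrightarrow> dec_parts l = []"
  by (auto simp: dec_parts_def filter_empty_conv)

lemma partition_dec_parts: "partition l \<Longrightarrow> partition (dec_parts l)"
  by (induction l) (auto simp: dec_parts_def partition_Cons intro: diff_le_mono)

lemma length_dec_parts_le: "length (dec_parts l) \<le> length l"
  unfolding dec_parts_def by (metis length_filter_le length_map)

text \<open>Truncated subtraction also fits the indices beyond the new length. The filter keeps
  positions intact because the parts that vanish form a final segment.\<close>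

lemma part_dec_parts: "partition l \<Longrightarrow> part (dec_parts l) j = part l j - 1"
proof (induction l arbitrary: j)
  case (Cons x l)
  show ?case
  proof (cases "x \<le> 1")
    case True
    then have "dec_parts (x # l) = []"
      using Cons.prems by (intro dec_parts_all_one) (auto simp: partition_Cons)
    moreover have "part (x # l) j \<le> 1"
      using True Cons.prems by (auto simp: part_def partition_Cons nth_Cons split: nat.splits)
        (metis Suc_diff_1 le_trans less_Suc_eq_le nth_mem One_nat_def Suc_le_lessD)
    ultimately show ?thesis by simp
  next
    case False
    then have "dec_parts (x # l) = (x - 1) # dec_parts l"
      by (simp add: dec_parts_def)
    then show ?thesis
      using Cons by (simp add: part_Cons partition_Cons)
  qed
qed (simp add: dec_parts_def)

text \<open>The parts lost are trailing ones, so padding to the original length restores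
  them.\<close>

lemma inc_dec_parts: "partition l \<Longrightarrow> inc_parts (length l) (dec_parts l) = l"
proof (induction l)
  case (Cons x l)
  show ?case
  proof (cases "x \<le> 1")
    case True
    then have "\<forall>y\<in>set (x # l). y = 1"
      using Cons.prems by (fastforce simp: partition_def)
    moreover from this have "dec_parts (x # l) = []"
      by (intro dec_parts_all_one) auto
    ultimately show ?thesis
      by (simp add: inc_parts_def) (metis replicate_length_same)
  next
    case False
    then have "dec_parts (x # l) = (x - 1) # dec_parts l"
      by (simp add: dec_parts_def)
    then show ?thesis
      using Cons False by (simp add: inc_parts_def partition_Cons)
  qed
qed (simp add: dec_parts_def inc_parts_def)

lemma dec_inc_parts: "partition l \<Longrightarrow> dec_parts (inc_parts a l) = l"
  by (auto simp: dec_parts_def inc_parts_def partition_def comp_def filter_replicate)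

lemma length_inc_parts: "length l \<le> a \<Longrightarrow> length (inc_parts a l) = a"
  by (simp add: inc_parts_def)

lemma partition_inc_parts: "partition l \<Longrightarrow> partition (inc_parts a l)"
  by (auto simp: inc_parts_def partition_def sorted_wrt_append sorted_wrt_map
      intro: sorted_wrt_iff_nth_less[THEN iffD2])

lemma part_inc_parts:
  "length l \<le> a \<Longrightarrow> part (inc_parts a l) j = (if 1 \<le> j \<and> j \<le> a then Suc (part l j) else 0)"
  by (auto simp: part_def inc_parts_def nth_append)

lemma sum_list_inc_parts: "length l \<le> a \<Longrightarrow> sum_list (inc_parts a l) = sum_list l + a"
  using sum_list_Suc[of "\<lambda>x. x" l] by (simp add: inc_parts_def sum_list_replicate)

lemma sum_list_dec_parts: "partition l \<Longrightarrow> sum_list (dec_parts l) + length l = sum_list l"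
  using sum_list_inc_parts[OF length_dec_parts_le, of l] by (simp add: inc_dec_parts)

section \<open>Profile (4, 0) and counts with separate bounds\<close>

lemma cylindric_partition_40:
  "cylindric_partition (4, 0) (l1, l2) \<longleftrightarrow> partition l1 \<and> partition l2 \<and>
     (\<forall>j\<ge>1. part l2 j \<le> part l1 j) \<and> (\<forall>j\<ge>1. part l1 (j + 4) \<le> part l2 j)"
  by (simp add: cylindric_partition_def)

text \<open>A part is positive exactly at the indices up to the length. The two bounds come from the
  interlacing conditions at the last index of \<open>l2\<close> and at the first index beyond
  it.\<close>

lemma cylindric_partition_40_length:
  assumes "cylindric_partition (4, 0) (l1, l2)"
  shows "length l2 \<le> length l1" "length l1 \<le> length l2 + 4"
proof -
  have p: "partition l1" "partition l2"
    and le: "\<And>j. j \<ge> 1 \<Longrightarrow> part l2 j \<le> part l1 j" "\<And>j. j \<ge> 1 \<Longrightarrow> part l1 (j + 4) \<le> part l2 j"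
    using assms by (auto simp: cylindric_partition_40)
  show "length l2 \<le> length l1"
  proof (cases "length l2 = 0")
    case False
    then have "0 < part l1 (length l2)"
      using part_pos_iff[OF p(2), of "length l2"] le(1)[of "length l2"]
      by (cases l2) auto
    then show ?thesis using part_pos_iff[OF p(1)] by simp
  qed simp
  show "length l1 \<le> length l2 + 4"
  proof (rule ccontr)
    assume "\<not> ?thesis"
    then have "0 < part l1 (Suc (length l2) + 4)"
      using part_pos_iff[OF p(1)] by simp
    then have "0 < part l2 (Suc (length l2))"
      using le(2)[of "Suc (length l2)"] by simp
    then show False using part_pos_iff[OF p(2)] by simp
  qed
qed

text \<open>The bounds are strict so that the counts vanish, as the recurrence requires, when one of the
  bounds is 0.\<close>

definition bcyl_set :: "nat \<Rightarrow> nat \<Rightarrow> nat \<Rightarrow> (nat list \<times> nat list) set" where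
  "bcyl_set a b m = {(l1, l2). cylindric_partition (4, 0) (l1, l2) \<and>
     length l1 < a \<and> length l2 < b \<and> cyl_size (l1, l2) = m}"

definition BCP :: "nat \<Rightarrow> nat \<Rightarrow> rat fps" where
  "BCP a b = Abs_fps (\<lambda>m. of_nat (card (bcyl_set a b m)))"

lemma CP_eq_BCP: "CP (4, 0) n = BCP (Suc n) (Suc n)"
  by (simp add: CP_def BCP_def cyl_set_def bcyl_set_def less_Suc_eq_le)

lemma finite_bcyl_set: "finite (bcyl_set a b m)"
  by (rule finite_subset[OF _ finite_cyl_set[of "(4, 0)" "max a b" m]])
    (auto simp: bcyl_set_def cyl_set_def)

lemma BCP_0 [simp]: "BCP a 0 = 0"
  by (simp add: BCP_def bcyl_set_def fps_eq_iff)

lemma BCP_diag: "BCP a (Suc a) = BCP a a"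
proof -
  have "bcyl_set a (Suc a) m = bcyl_set a a m" for m
    using cylindric_partition_40_length(1) by (fastforce simp: bcyl_set_def)
  then show ?thesis by (simp add: BCP_def)
qed

text \<open>\<open>length l2 < b\<close> already forces \<open>length l1 < b + 4\<close>, so
  relaxing the first bound further adds nothing.\<close>

lemma BCP_antidiag: "BCP (b + 5) b = BCP (b + 4) b"
proof -
  have "bcyl_set (b + 5) b m = bcyl_set (b + 4) b m" for m
    using cylindric_partition_40_length(2) by (fastforce simp: bcyl_set_def)
  then show ?thesis by (simp add: BCP_def)
qed

section \<open>Column removal as a bijection, and the recurrence\<close>

lemma cylindric_partition_40_dec_parts:
  "cylindric_partition (4, 0) (l1, l2) \<Longrightarrow> cylindric_partition (4, 0) (dec_parts l1, dec_parts l2)"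
  by (auto simp: cylindric_partition_40 partition_dec_parts part_dec_parts intro: diff_le_mono)

text \<open>The added columns of heights \<open>a\<close> and \<open>b\<close> must themselves
  interlace: \<open>b \<le> a\<close> serves the first condition, \<open>a \<le> b + 4\<close> the
  second.\<close>

lemma cylindric_partition_40_inc_parts:
  assumes "cylindric_partition (4, 0) (l1, l2)" "length l1 \<le> a" "length l2 \<le> b"
    and "b \<le> a" "a \<le> b + 4"
  shows "cylindric_partition (4, 0) (inc_parts a l1, inc_parts b l2)"
  using assms by (auto simp: cylindric_partition_40 partition_inc_parts part_inc_parts)

lemma card_full_cylindric_partitions:
  assumes "b \<le> a" "a \<le> b + 4"
  shows "card {(l1, l2). cylindric_partition (4, 0) (l1, l2) \<and> length l1 = a \<and> length l2 = b \<and>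
      cyl_size (l1, l2) = m + (a + b)} = card (bcyl_set (Suc a) (Suc b) m)"
    (is "card ?D = card ?E")
proof (rule bij_betw_same_card)
  show "bij_betw (\<lambda>(l1, l2). (dec_parts l1, dec_parts l2)) ?D ?E"
  proof (rule bij_betw_byWitness[where f' = "\<lambda>(l1, l2). (inc_parts a l1, inc_parts b l2)"])
    show "\<forall>p\<in>?D. (\<lambda>(l1, l2). (inc_parts a l1, inc_parts b l2))
        ((\<lambda>(l1, l2). (dec_parts l1, dec_parts l2)) p) = p"
      by (auto simp: cylindric_partition_40 inc_dec_parts)
    show "\<forall>p\<in>?E. (\<lambda>(l1, l2). (dec_parts l1, dec_parts l2))
        ((\<lambda>(l1, l2). (inc_parts a l1, inc_parts b l2)) p) = p"
      by (auto simp: bcyl_set_def cylindric_partition_40 dec_inc_parts)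
    show "(\<lambda>(l1, l2). (dec_parts l1, dec_parts l2)) ` ?D \<subseteq> ?E"
    proof clarify
      fix l1 l2 assume *: "cylindric_partition (4, 0) (l1, l2)" "a = length l1" "b = length l2"
        "cyl_size (l1, l2) = m + (length l1 + length l2)"
      then have "partition l1" "partition l2" by (auto simp: cylindric_partition_40)
      then have "sum_list (dec_parts l1) + length l1 = sum_list l1"
        "sum_list (dec_parts l2) + length l2 = sum_list l2"
        by (auto intro: sum_list_dec_parts)
      with * show "(dec_parts l1, dec_parts l2) \<in> bcyl_set (Suc (length l1)) (Suc (length l2)) m"
        by (simp add: bcyl_set_def cyl_size_def cylindric_partition_40_dec_parts less_Suc_eq_le
            length_dec_parts_le)
    qed
    show "(\<lambda>(l1, l2). (inc_parts a l1, inc_parts b l2)) ` ?E \<subseteq> ?D"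
      using assms
      by (auto simp: bcyl_set_def cyl_size_def less_Suc_eq_le cylindric_partition_40_inc_parts
          length_inc_parts sum_list_inc_parts)
  qed
qed

lemma length_le_sum_list_partition: "partition l \<Longrightarrow> length l \<le> sum_list l"
  using sum_list_dec_parts[of l] by simp

text \<open>Pairs attaining both bounds contribute
  \<open>fps_X ^ (a + b) * BCP (Suc a) (Suc b)\<close>, which is moved to the left. The remaining
  pairs form a union of two sets, counted by inclusion-exclusion.\<close>

lemma BCP_recurrence:
  assumes "b \<le> a" "a \<le> b + 4"
  shows "(1 - fps_X ^ (a + b)) * BCP (Suc a) (Suc b) =
    BCP a (Suc b) + BCP (Suc a) b - BCP a b"
proof -
  define D where "D m = {(l1, l2). cylindric_partition (4, 0) (l1, l2) \<and> length l1 = a \<and>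
    length l2 = b \<and> cyl_size (l1, l2) = m}" for m
  have split: "bcyl_set (Suc a) (Suc b) m =
      D m \<union> (bcyl_set a (Suc b) m \<union> bcyl_set (Suc a) b m)" for m
    by (auto simp: D_def bcyl_set_def)
  have disj: "D m \<inter> (bcyl_set a (Suc b) m \<union> bcyl_set (Suc a) b m) = {}" for m
    by (auto simp: D_def bcyl_set_def)
  have int: "bcyl_set a (Suc b) m \<inter> bcyl_set (Suc a) b m = bcyl_set a b m" for m
    by (auto simp: bcyl_set_def)
  have fin: "finite (D m)" for m
    using finite_bcyl_set[of "Suc a" "Suc b" m] split[of m] by simp
  have D: "card (D m) = (if m < a + b then 0 else card (bcyl_set (Suc a) (Suc b) (m - (a + b))))" for m
  proof (cases "m < a + b")
    \<comment> \<open>The \<open>a + b\<close> positive parts alone would exceed the size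
      \<open>m\<close>.\<close>
    case True
    then have "D m = {}"
      by (auto simp: D_def cylindric_partition_40 cyl_size_def
          dest!: length_le_sum_list_partition)
    with True show ?thesis by simp
  next
    case False
    then show ?thesis
      using card_full_cylindric_partitions[OF assms, of "m - (a + b)"] by (simp add: D_def)
  qed
  have "card (bcyl_set (Suc a) (Suc b) m) + card (bcyl_set a b m) =
      card (D m) + (card (bcyl_set a (Suc b) m) + card (bcyl_set (Suc a) b m))" for m
    using card_Un_disjoint[OF fin _ disj, of m]
      card_Un_Int[OF finite_bcyl_set[of a "Suc b" m] finite_bcyl_set[of "Suc a" b m]]
    by (simp add: split[of m] int finite_bcyl_set)
  then have "of_nat (card (bcyl_set (Suc a) (Suc b) m)) + of_nat (card (bcyl_set a b m)) =
      (of_nat (card (D m)) + (of_nat (card (bcyl_set a (Suc b) m)) +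
        of_nat (card (bcyl_set (Suc a) b m))) :: rat)" for m
    by (metis of_nat_add)
  then have "BCP (Suc a) (Suc b) + BCP a b =
      fps_X ^ (a + b) * BCP (Suc a) (Suc b) + (BCP a (Suc b) + BCP (Suc a) b)"
    by (auto simp: fps_eq_iff BCP_def fps_X_power_mult_nth D)
  then show ?thesis
    by (simp add: algebra_simps)
qed

section \<open>Boundary cases and removal of odd differences\<close>

lemma BCP_recurrence_diag:
  "(1 - fps_X ^ (2 * a)) * BCP (Suc a) (Suc a) = BCP (Suc a) a"
  using BCP_recurrence[of a a] by (simp add: BCP_diag mult_2)

text \<open>With \<open>b = Suc c\<close>, the two subtracted or added terms with second bound
  \<open>c\<close> cancel by \<open>BCP_antidiag\<close>. For \<open>b = 0\<close> both sides
  vanish.\<close>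

lemma BCP_recurrence_antidiag:
  "(1 - fps_X ^ (2 * b + 2)) * BCP (b + 4) b = BCP (b + 3) b"
proof (cases b)
  case (Suc c)
  then show ?thesis
    using BCP_recurrence[of c "c + 4"] BCP_antidiag[of c]
    by (simp add: mult_2 eval_nat_numeral)
qed simp

text \<open>The recurrence at difference 1 between the bounds, with both series of difference 1
  rewritten as multiples of diagonal ones. Only differences 0 and 2 remain.\<close>

lemma BCP_step_diag:
  "(1 - fps_X ^ (2 * j + 1)) * (1 - fps_X ^ (2 * j + 2)) * BCP (j + 2) (j + 2) =
    fps_X ^ (2 * j) * BCP (j + 1) (j + 1) + BCP (j + 2) j"
proof -
  have 1: "(1 - fps_X ^ (2 * j + 2)) * BCP (j + 2) (j + 2) = BCP (j + 2) (j + 1)"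
    using BCP_recurrence_diag[of "j + 1"] by simp
  have 2: "(1 - fps_X ^ (2 * j + 1)) * BCP (j + 2) (j + 1) =
      BCP (j + 1) (j + 1) + BCP (j + 2) j - BCP (j + 1) j"
    using BCP_recurrence[of j "j + 1"] by (simp add: mult_2)
  have 3: "(1 - fps_X ^ (2 * j)) * BCP (j + 1) (j + 1) = BCP (j + 1) j"
    using BCP_recurrence_diag[of j] by simp
  show ?thesis
    unfolding mult.assoc 1 2  3[symmetric] by (simp add: algebra_simps)
qed

text \<open>The mirror image of \<open>BCP_step_diag\<close>: difference 3 is eliminated, leaving
  differences 4 and 2.\<close>

lemma BCP_step_antidiag:
  "(1 - fps_X ^ (2 * j + 3)) * (1 - fps_X ^ (2 * j + 4)) * BCP (j + 5) (j + 1) =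
    fps_X ^ (2 * j + 2) * BCP (j + 4) j + BCP (j + 3) (j + 1)"
proof -
  have 1: "(1 - fps_X ^ (2 * j + 4)) * BCP (j + 5) (j + 1) = BCP (j + 4) (j + 1)"
    using BCP_recurrence_antidiag[of "j + 1"] by (simp add: eval_nat_numeral)
  have 2: "(1 - fps_X ^ (2 * j + 3)) * BCP (j + 4) (j + 1) =
      BCP (j + 3) (j + 1) + BCP (j + 4) j - BCP (j + 3) j"
    using BCP_recurrence[of j "j + 3"] by (simp add: eval_nat_numeral)
  show ?thesis
    unfolding mult.assoc 1 2 by (simp add: BCP_recurrence_antidiag[of j, symmetric] algebra_simps)
qed

text \<open>At difference 2 the neighbours have differences 1 and 3. Both boundary relations replace
  them with the same factor \<open>1 - fps_X ^ (2 * j + 2)\<close>.\<close>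

lemma BCP_step_middle:
  "(1 - fps_X ^ (2 * j + 2)) * BCP (j + 3) (j + 1) =
    (1 - fps_X ^ (2 * j + 2)) * (BCP (j + 2) (j + 2) + BCP (j + 4) j) - BCP (j + 2) j"
proof -
  have 1: "(1 - fps_X ^ (2 * j + 2)) * BCP (j + 2) (j + 2) = BCP (j + 2) (j + 1)"
    using BCP_recurrence_diag[of "j + 1"] by simp
  have 2: "(1 - fps_X ^ (2 * j + 2)) * BCP (j + 3) (j + 1) =
      BCP (j + 2) (j + 1) + BCP (j + 3) j - BCP (j + 2) j"
    using BCP_recurrence[of j "j + 2"] by (simp add: eval_nat_numeral)
  show ?thesis
    unfolding 2 distrib_left 1 BCP_recurrence_antidiag ..
qed

section \<open>Elimination down to the diagonal\<close>

text \<open>Here \<open>A\<close>, \<open>B\<close>, \<open>C\<close> stand for differences 0, 2, 4,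
  and \<open>x\<close> for \<open>q ^ (2 * k)\<close>. The \<open>A\<close> relations express each
  \<open>B\<close> through the diagonal, the \<open>B\<close> relations then give multiples of each
  \<open>C\<close>, and the \<open>C\<close> relation links these.\<close>

lemma third_order_elimination:
  fixes q x A0 A1 A2 A3 B0 B1 B2 C1 C2 :: "'a :: comm_ring_1"
  assumes A: "(1 - x * q) * (1 - x * q^2) * A1 = x * A0 + B0"
    "(1 - x * q^3) * (1 - x * q^4) * A2 = x * q^2 * A1 + B1"
    "(1 - x * q^5) * (1 - x * q^6) * A3 = x * q^4 * A2 + B2"
    and C: "(1 - x * q^3) * (1 - x * q^4) * C2 = x * q^2 * C1 + B1"
    and B: "(1 - x * q^2) * B1 = (1 - x * q^2) * (A1 + C1) - B0"
    "(1 - x * q^4) * B2 = (1 - x * q^4) * (A2 + C2) - B1"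
  shows "(1 - x * q^2) * (1 - x * q^3) * (1 - x * q^4) * (1 - x * q^5) * (1 - x * q^6) * A3 =
    (1 + x * q^2 + x * q^3 + x * q^4) * (1 - x * q^2) * (1 - x * q^3) * (1 - x * q^4) * A2
    - (x^2 * q^5 + x^2 * q^4 + x^2 * q^3) * (1 - x * q^2) * A1 - x^2 * q^2 * A0"
    (is "?l = ?r")
proof -
  have B0: "B0 = (1 - x * q) * (1 - x * q^2) * A1 - x * A0"
    and B1: "B1 = (1 - x * q^3) * (1 - x * q^4) * A2 - x * q^2 * A1"
    and B2: "B2 = (1 - x * q^5) * (1 - x * q^6) * A3 - x * q^4 * A2"
    using A by simp_all
  have C1: "(1 - x * q^2) * C1 = (1 - x * q^2) * (B1 - A1) + B0"
    and C2: "(1 - x * q^4) * C2 = (1 - x * q^4) * (B2 - A2) + B1"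
    using B by (simp_all add: algebra_simps)
  \<comment> \<open>Only \<open>(1 - x * q^2) * C1\<close> is known, so the \<open>C\<close>
    relation is first multiplied by \<open>1 - x * q^2\<close>.\<close>
  have "(1 - x * q^2) * (1 - x * q^3) * ((1 - x * q^4) * C2) =
      x * q^2 * ((1 - x * q^2) * C1) + (1 - x * q^2) * B1"
    using arg_cong[OF C, of "\<lambda>t. (1 - x * q^2) * t"] by (simp add: algebra_simps)
  then have "(1 - x * q^2) * (1 - x * q^3) * ((1 - x * q^4) * (B2 - A2) + B1) =
      x * q^2 * ((1 - x * q^2) * (B1 - A1) + B0) + (1 - x * q^2) * B1"
    unfolding C1 C2 .
  moreover have "?l - ?r = (1 - x * q^2) * (1 - x * q^3) * ((1 - x * q^4) * (B2 - A2) + B1) -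
      (x * q^2 * ((1 - x * q^2) * (B1 - A1) + B0) + (1 - x * q^2) * B1)"
    unfolding B0 B1 B2 by (simp add: algebra_simps eval_nat_numeral)
  ultimately show ?thesis by simp
qed

section \<open>The recurrence for the diagonal counts\<close>

theorem theorem5p1:
  fixes n :: nat
  assumes "n \<ge> 3"
  shows "CP (4, 0) n =
    (1 + fps_X ^ (2*n-4) + fps_X ^ (2*n-3) + fps_X ^ (2*n-2))
      / ((1 - fps_X ^ (2*n-1)) * (1 - fps_X ^ (2*n))) * CP (4, 0) (n-1)
    - (fps_X ^ (4*n-7) + fps_X ^ (4*n-8) + fps_X ^ (4*n-9))
      / ((1 - fps_X ^ (2*n-3)) * (1 - fps_X ^ (2*n-2)) * (1 - fps_X ^ (2*n-1)) * (1 - fps_X ^ (2*n)))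
      * CP (4, 0) (n-2)
    - fps_X ^ (4*n-10)
      / ((1 - fps_X ^ (2*n-4)) * (1 - fps_X ^ (2*n-3)) * (1 - fps_X ^ (2*n-2))
          * (1 - fps_X ^ (2*n-1)) * (1 - fps_X ^ (2*n)))
      * CP (4, 0) (n-3)"
proof -
  obtain k where n: "n = k + 3"
    using assms by (metis add.commute le_Suc_ex)
  \<comment> \<open>All dependence on \<open>k\<close> goes into \<open>x\<close>, leaving numeral
    exponents of \<open>q\<close>.\<close>
  define q x :: "rat fps" where "q = fps_X" and "x = fps_X ^ (2 * k)"
  have pow: "fps_X ^ (2 * k + i) = x * q ^ i" for i
    by (simp add: q_def x_def power_add)
  have pow2: "fps_X ^ (4 * k + i) = x^2 * q ^ i" for i
    by (simp add: q_def x_def power_add flip: power_mult)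
  define A where "A j = CP (4, 0) j" for j
  define e where "e i = 1 - x * q ^ i" for i
  \<comment> \<open>Constant term 1 makes the denominators units; \<open>i > 0\<close> matters when
    \<open>k = 0\<close>, where \<open>x = 1\<close>.\<close>
  have e_unit: "e i $ 0 = 1" if "i > 0" for i
    using that by (simp add: e_def flip: pow)
  have A_eq: "A j = BCP (j + 1) (j + 1)" for j
    by (simp add: A_def CP_eq_BCP)
  have idx: "2 * (k + 1) = 2 * k + 2" "2 * k + 2 + 1 = 2 * k + 3" "2 * k + 2 + 2 = 2 * k + 4"
    "2 * (k + 2) = 2 * k + 4" "2 * k + 4 + 1 = 2 * k + 5" "2 * k + 4 + 2 = 2 * k + 6"
    "k + 1 + 1 = k + 2" "k + 1 + 2 = k + 3" "k + 1 + 3 = k + 4" "k + 1 + 4 = k + 5"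
    "k + 2 + 1 = k + 3" "k + 2 + 2 = k + 4" "k + 3 + 1 = k + 4"
    by simp_all
  \<comment> \<open>The claim with denominators cleared.\<close>
  have main: "e 2 * e 3 * e 4 * e 5 * e 6 * A (k + 3) =
      (1 + x * q^2 + x * q^3 + x * q^4) * e 2 * e 3 * e 4 * A (k + 2)
      - (x^2 * q^5 + x^2 * q^4 + x^2 * q^3) * e 2 * A (k + 1) - x^2 * q^2 * A k"
    unfolding e_def
  proof (rule third_order_elimination)
    show "(1 - x * q) * (1 - x * q^2) * A (k + 1) = x * A k + BCP (k + 2) k"
      using BCP_step_diag[of k] unfolding pow x_def[symmetric] by (simp add: A_def CP_eq_BCP)
    show "(1 - x * q^3) * (1 - x * q^4) * A (k + 2) = x * q^2 * A (k + 1) + BCP (k + 3) (k + 1)"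
      using BCP_step_diag[of "k + 1"] by (simp only: A_eq idx pow)
    show "(1 - x * q^5) * (1 - x * q^6) * A (k + 3) = x * q^4 * A (k + 2) + BCP (k + 4) (k + 2)"
      using BCP_step_diag[of "k + 2"] by (simp only: A_eq idx pow)
    show "(1 - x * q^3) * (1 - x * q^4) * BCP (k + 5) (k + 1) =
        x * q^2 * BCP (k + 4) k + BCP (k + 3) (k + 1)"
      using BCP_step_antidiag[of k] by (simp only: pow)
    show "(1 - x * q^2) * BCP (k + 3) (k + 1) =
        (1 - x * q^2) * (A (k + 1) + BCP (k + 4) k) - BCP (k + 2) k"
      using BCP_step_middle[of k] by (simp only: A_eq idx pow)
    show "(1 - x * q^4) * BCP (k + 4) (k + 2) =
        (1 - x * q^4) * (A (k + 2) + BCP (k + 5) (k + 1)) - BCP (k + 3) (k + 1)"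
      using BCP_step_middle[of "k + 1"] by (simp only: A_eq idx pow)
  qed
  have div: "f / d * d = f" if "d $ 0 = 1" for f d :: "rat fps"
    using that by (simp add: fps_divide_unit mult.assoc inverse_mult_eq_1)
  define y where "y = (1 + x * q^2 + x * q^3 + x * q^4) / (e 5 * e 6)"
  define z where "z = (x^2 * q^5 + x^2 * q^4 + x^2 * q^3) / (e 3 * e 4 * e 5 * e 6)"
  define w where "w = x^2 * q^2 / (e 2 * e 3 * e 4 * e 5 * e 6)"
  have y: "y * (e 5 * e 6) = 1 + x * q^2 + x * q^3 + x * q^4"
    unfolding y_def by (rule div) (simp add: e_unit)
  have z: "z * (e 3 * e 4 * e 5 * e 6) = x^2 * q^5 + x^2 * q^4 + x^2 * q^3"
    unfolding z_def by (rule div) (simp add: e_unit)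
  have w: "w * (e 2 * e 3 * e 4 * e 5 * e 6) = x^2 * q^2"
    unfolding w_def by (rule div) (simp add: e_unit)
  have "e 2 * e 3 * e 4 * e 5 * e 6 * A (k + 3) =
      e 2 * e 3 * e 4 * e 5 * e 6 * (y * A (k + 2) - z * A (k + 1) - w * A k)"
    unfolding main y[symmetric] z[symmetric] w[symmetric] by (simp add: algebra_simps)
  moreover have "e 2 * e 3 * e 4 * e 5 * e 6 \<noteq> 0"
    using e_unit by (metis mult_eq_0_iff fps_zero_nth zero_less_numeral zero_neq_one)
  ultimately have "A (k + 3) = y * A (k + 2) - z * A (k + 1) - w * A k"
    by (metis mult_left_cancel)
  \<comment> \<open>With \<open>n = k + 3\<close> no natural subtraction in the exponents or indices
    truncates.\<close>
  moreover have exps: "2 * n = 2 * k + 6" "4 * n = 4 * k + 12"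
    "2 * k + 6 - 4 = 2 * k + 2" "2 * k + 6 - 3 = 2 * k + 3" "2 * k + 6 - 2 = 2 * k + 4"
    "2 * k + 6 - 1 = 2 * k + 5" "4 * k + 12 - 7 = 4 * k + 5" "4 * k + 12 - 8 = 4 * k + 4"
    "4 * k + 12 - 9 = 4 * k + 3" "4 * k + 12 - 10 = 4 * k + 2"
    "n - 1 = k + 2" "n - 2 = k + 1" "n - 3 = k"
    by (simp_all add: n)
  ultimately show ?thesis
    unfolding exps pow pow2 y_def z_def w_def e_def A_def by (simp only: n)
qed

end
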